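(* Let $H$ be a separable complex Hilbert space and let $V\in\mathcal{B}(H)$ be an isometry, not unitary, that generates a $C^*$-algebra $\mathcal{A}$. Then: (i) $\mathcal{G}=\{V,VV^*\}$ is a hyperrigid generator for $\mathcal{A}$; (ii) the smaller generating set $\mathcal{G}_0=\{V\}$ is not hyperrigid.
   Context: Here $\mathcal{A}$ is the $C^*$-subalgebra of $\mathcal{B}(H)$ generated by $V$. UCP means unital completely positive. A finite or countably infinite set $\mathcal{G}$ of generators of a $C^*$-algebra $\mathcal{A}$ is called hyperrigid (a hyperrigid generator for $\mathcal{A}$) if for every faithful representation $\mathcal{A}\subseteq\mathcal{B}(L)$ on a Hilbert space $L$ and every sequence of UCP maps $\phi_n:\mathcal{B}(L)\to\mathcal{B}(L)$, $n=1,2,\dots$, $$\lim_{n\to\infty}\|\phi_n(g)-g\|=0\ \ \forall g\in\mathcal{G}\ \Longrightarrow\ \lim_{n\to\infty}\|\phi_n(a)-a\|=0\ \ \forall a\in\mathcal{A}.$$ Representations of unital $C^*$-algebras are understood to be nondegenerate (unital). *)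

theory Defs
  imports "HOL-Analysis.Analysis"
begin

section \<open>Complex Hilbert spaces\<close>

(* The real inner product inherited from real_inner, which supplies the norm and
   the topology, is the real part of the complex one. Hence cinner x x = (norm x)^2.
   The form is linear in the first argument and conjugate-linear in the second. *)
class complex_hilbert = real_inner + complete_space +
  fixes scaleC :: "complex \<Rightarrow> 'a \<Rightarrow> 'a"  (infixr \<open>*\<^sub>C\<close> 75)
    and cinner :: "'a \<Rightarrow> 'a \<Rightarrow> complex"
  assumes scaleC_add_right: "c *\<^sub>C (x + y) = c *\<^sub>C x + c *\<^sub>C y"
    and scaleC_add_left: "(c + d) *\<^sub>C x = c *\<^sub>C x + d *\<^sub>C x"
    and scaleC_scaleC: "c *\<^sub>C d *\<^sub>C x = (c * d) *\<^sub>C x"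
    and scaleC_of_real: "complex_of_real r *\<^sub>C x = r *\<^sub>R x"
    and cinner_commute: "cinner x y = cnj (cinner y x)"
    and cinner_add_left: "cinner (x + y) z = cinner x z + cinner y z"
    and cinner_scaleC_left: "cinner (c *\<^sub>C x) y = c * cinner x y"
    and Re_cinner: "Re (cinner x y) = x \<bullet> y"

lemma cinner_scaleC_right: "cinner x (c *\<^sub>C y) = cnj c * cinner x y"
  by (metis cinner_commute cinner_scaleC_left complex_cnj_mult)

lemma cinner_self: "cinner x x = complex_of_real ((norm x)\<^sup>2)"
proof (rule complex_eqI)
  show "Re (cinner x x) = Re (complex_of_real ((norm x)\<^sup>2))"
    by (simp only: Re_cinner Re_complex_of_real power2_norm_eq_inner)
  have "Im (cinner x x) = Im (cnj (cinner x x))"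
    using cinner_commute by (rule arg_cong)
  then show "Im (cinner x x) = Im (complex_of_real ((norm x)\<^sup>2))" by simp
qed

lemma norm_scaleC: "norm (c *\<^sub>C x) = cmod c * norm x"
proof -
  have "complex_of_real ((norm (c *\<^sub>C x))\<^sup>2) = c * cnj c * cinner x x"
    by (simp only: cinner_self[symmetric] cinner_scaleC_left cinner_scaleC_right mult_ac)
  also have "\<dots> = complex_of_real ((cmod c * norm x)\<^sup>2)"
    by (simp only: cinner_self complex_norm_square[symmetric] power_mult_distrib of_real_mult of_real_power)
  finally have "(norm (c *\<^sub>C x))\<^sup>2 = (cmod c * norm x)\<^sup>2"
    by (simp only: of_real_eq_iff)
  then show ?thesis by (simp add: power2_eq_iff_nonneg)
qed

lemma bounded_linear_scaleC_right: "bounded_linear (\<lambda>x. c *\<^sub>C x)"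
proof (rule bounded_linear_intro[where K = "cmod c"])
  show "c *\<^sub>C r *\<^sub>R x = r *\<^sub>R c *\<^sub>C x" for r x
    by (metis mult.commute scaleC_of_real scaleC_scaleC)
qed (simp_all add: scaleC_add_right norm_scaleC)


section \<open>The algebra of bounded operators\<close>

(* blinfun is the type of bounded real-linear maps; B(H) is its subset of
   complex-linear maps. Its operator norm is the usual one on B(H). *)
definition bounded_ops :: "('a::complex_hilbert \<Rightarrow>\<^sub>L 'a) set" where
  "bounded_ops = {T. \<forall>c x. blinfun_apply T (c *\<^sub>C x) = c *\<^sub>C blinfun_apply T x}"

lift_definition scaleC_op ::
    "complex \<Rightarrow> ('a::complex_hilbert \<Rightarrow>\<^sub>L 'a) \<Rightarrow> ('a \<Rightarrow>\<^sub>L 'a)"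
  is "\<lambda>c T x. c *\<^sub>C T x"
  using bounded_linear_compose[OF bounded_linear_scaleC_right] .

definition adj :: "('a::complex_hilbert \<Rightarrow>\<^sub>L 'a) \<Rightarrow> ('a \<Rightarrow>\<^sub>L 'a)" where
  "adj T = (THE S. S \<in> bounded_ops \<and>
     (\<forall>x y. cinner (blinfun_apply T x) y = cinner x (blinfun_apply S y)))"

definition is_isometry :: "('a::complex_hilbert \<Rightarrow>\<^sub>L 'a) \<Rightarrow> bool" where
  "is_isometry V \<longleftrightarrow> V \<in> bounded_ops \<and> (\<forall>x. norm (blinfun_apply V x) = norm x)"

definition is_unitary :: "('a::complex_hilbert \<Rightarrow>\<^sub>L 'a) \<Rightarrow> bool" where
  "is_unitary U \<longleftrightarrow> U \<in> bounded_ops \<and>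
     adj U o\<^sub>L U = id_blinfun \<and> U o\<^sub>L adj U = id_blinfun"


subsection \<open>Existence of adjoints\<close>

lemma riesz_real:
  fixes f :: "'a::{real_inner,complete_space} \<Rightarrow> real"
  assumes f: "bounded_linear f"
  shows "\<exists>u. \<forall>x. f x = u \<bullet> x"
proof -
  interpret bounded_linear f by fact
  define g where "g x = (norm x)\<^sup>2 / 2 - f x" for x
  obtain K where K: "\<And>x. norm (f x) \<le> norm x * K" using bounded by blast
  have lower: "- (K\<^sup>2) / 2 \<le> g x" for x
  proof -
    have "f x \<le> norm x * K" using K[of x] by simp
    moreover have "0 \<le> (norm x - K)\<^sup>2" by simp
    ultimately show ?thesis unfolding g_def by (simp add: power2_eq_square algebra_simps)
  qed
  then have bdd: "bdd_below (range g)" by (auto intro!: bdd_belowI)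
  define m where "m = Inf (range g)"
  have mle: "m \<le> g x" for x unfolding m_def by (rule cInf_lower[OF _ bdd]) simp
  have "\<exists>x. g x < m + inverse (real (Suc n))" for n
  proof -
    have "Inf (range g) < m + inverse (real (Suc n))" unfolding m_def by simp
    then show ?thesis using cInf_less_iff[OF _ bdd] by auto
  qed
  then obtain X where X: "\<And>n. g (X n) < m + inverse (real (Suc n))" by metis
  have par: "(dist x y)\<^sup>2 \<le> 4 * (g x - m) + 4 * (g y - m)" for x y
  proof -
    have "g x + g y - 2 * g ((1/2) *\<^sub>R (x + y)) = (dist x y)\<^sup>2 / 4"
      unfolding g_def dist_norm
      by (simp add: power2_norm_eq_inner algebra_simps inner_commute add scaleR)
    moreover have "m \<le> g ((1/2) *\<^sub>R (x + y))" by (rule mle)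
    ultimately show ?thesis by simp
  qed
  have "Cauchy X"
  proof (rule metric_CauchyI)
    fix e :: real assume e: "0 < e"
    obtain N where N: "inverse (real (Suc N)) < e\<^sup>2 / 8"
      using reals_Archimedean[of "e\<^sup>2 / 8"] e by auto
    have small: "g (X n) - m < e\<^sup>2 / 8" if "n \<ge> N" for n
    proof -
      have "inverse (real (Suc n)) \<le> inverse (real (Suc N))" using that by simp
      then show ?thesis using X[of n] N by linarith
    qed
    have "dist (X i) (X j) < e" if "i \<ge> N" "j \<ge> N" for i j
    proof -
      have "(dist (X i) (X j))\<^sup>2 < e\<^sup>2"
        using par[of "X i" "X j"] small[OF that(1)] small[OF that(2)] unfolding power2_eq_square by argo
      then show ?thesis using e by (simp add: power_less_imp_less_base)
    qed
    then show "\<exists>M. \<forall>i\<ge>M. \<forall>j\<ge>M. dist (X i) (X j) < e" by blast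
  qed
  then obtain u where u: "X \<longlonglongrightarrow> u" using Cauchy_convergent convergent_def by blast
  have "(\<lambda>n. g (X n)) \<longlonglongrightarrow> g u" unfolding g_def by (intro tendsto_intros tendsto u) auto
  moreover have "(\<lambda>n. m + inverse (real (Suc n))) \<longlonglongrightarrow> m + 0"
    by (intro tendsto_intros LIMSEQ_inverse_real_of_nat)
  ultimately have "g u \<le> m + 0"
    by (rule LIMSEQ_le) (use X less_imp_le in blast)
  then have gmin: "g u \<le> g x" for x using mle[of x] by simp
  have "f h = u \<bullet> h" for h
  proof (rule ccontr)
    assume ne: "f h \<noteq> u \<bullet> h"
    define d where "d = u \<bullet> h - f h"
    define t where "t = - d / ((norm h)\<^sup>2 + 1)"
    have "0 \<le> g (u + t *\<^sub>R h) - g u" using gmin[of "u + t *\<^sub>R h"] by simp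
    also have "g (u + t *\<^sub>R h) - g u = t * d + t\<^sup>2 * (norm h)\<^sup>2 / 2"
      unfolding g_def d_def power2_norm_eq_inner
      by (simp add: add scaleR inner_add_left inner_add_right inner_commute power2_eq_square field_simps)
    also have "\<dots> \<le> t * d + t\<^sup>2 * ((norm h)\<^sup>2 + 1) / 2" by (simp add: field_simps)
    also have "\<dots> = - (d\<^sup>2) / (2 * ((norm h)\<^sup>2 + 1))"
    proof -
      have "(- d / q) * d + (- d / q)\<^sup>2 * q / 2 = - (d\<^sup>2) / (2 * q)" if "q \<noteq> 0" for q
        using that by (simp add: power2_eq_square field_simps)
      moreover have "(norm h)\<^sup>2 + 1 \<noteq> 0" by (smt (verit) zero_le_power2)
      ultimately show ?thesis unfolding t_def by blast
    qed
    also have "\<dots> < 0"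
      using ne by (simp add: d_def add_nonneg_pos)
    finally show False by simp
  qed
  then show ?thesis by blast
qed

lemma cinner_eqI:
  assumes "\<And>x. cinner x y = cinner x z"
  shows "y = z"
proof -
  have "\<forall>x. x \<bullet> y = x \<bullet> z" by (simp add: assms flip: Re_cinner)
  then show ?thesis by (simp only: vector_eq_ldot)
qed

lemma adj_exists:
  assumes T: "T \<in> bounded_ops"
  shows "\<exists>S. S \<in> bounded_ops \<and>
     (\<forall>x y. cinner (blinfun_apply T x) y = cinner x (blinfun_apply S y))"
proof -
  have "\<exists>u. \<forall>x. blinfun_apply T x \<bullet> y = u \<bullet> x" for y
    by (rule riesz_real)
       (intro bounded_linear_inner_left_comp blinfun.bounded_linear_right)
  then obtain s where s: "\<And>x y. blinfun_apply T x \<bullet> y = s y \<bullet> x" by metis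
  have cin: "cinner (blinfun_apply T x) y = cinner x (s y)" for x y
  proof (rule complex_eqI)
    show "Re (cinner (blinfun_apply T x) y) = Re (cinner x (s y))" for x
      by (simp only: Re_cinner s) (rule inner_commute)
    from this[of "\<i> *\<^sub>C x"] T show "Im (cinner (blinfun_apply T x) y) = Im (cinner x (s y))"
      by (simp add: bounded_ops_def cinner_scaleC_left)
  qed
  have right_add: "cinner x (y + z) = cinner x y + cinner x z" for x y z :: 'a
    by (simp only: cinner_commute[of x] cinner_add_left complex_cnj_add)
  have add: "s (y + z) = s y + s z" for y z
    by (rule cinner_eqI) (simp only: right_add flip: cin)
  have sc: "s (c *\<^sub>C y) = c *\<^sub>C s y" for c y
    by (rule cinner_eqI) (simp only: cinner_scaleC_right flip: cin)
  have "bounded_linear s"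
  proof (rule bounded_linear_intro[where K = "norm T"])
    show "s (r *\<^sub>R y) = r *\<^sub>R s y" for r y by (metis sc scaleC_of_real)
    show "norm (s y) \<le> norm y * norm T" for y
    proof (cases "s y = 0")
      case False
      have "norm (s y) * norm (s y) = blinfun_apply T (s y) \<bullet> y"
        by (simp only: s flip: power2_norm_eq_inner power2_eq_square)
      also have "\<dots> \<le> norm (blinfun_apply T (s y)) * norm y" by (rule norm_cauchy_schwarz)
      also have "\<dots> \<le> norm T * norm (s y) * norm y"
        by (intro mult_right_mono norm_blinfun) simp
      finally have "norm (s y) * norm (s y) \<le> norm (s y) * (norm y * norm T)"
        by (simp only: mult_ac)
      then show ?thesis using False by simp
    qed simp
  qed (rule add)
  then have "blinfun_apply (Blinfun s) = s" by (rule bounded_linear_Blinfun_apply)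
  then have "Blinfun s \<in> bounded_ops \<and>
     (\<forall>x y. cinner (blinfun_apply T x) y = cinner x (blinfun_apply (Blinfun s) y))"
    using cin sc by (simp add: bounded_ops_def)
  then show ?thesis by blast
qed

lemma adj:
  assumes "T \<in> bounded_ops"
  shows adj_bounded_ops: "adj T \<in> bounded_ops"
    and cinner_adj: "cinner (blinfun_apply T x) y = cinner x (blinfun_apply (adj T) y)"
proof -
  have "\<exists>!S. S \<in> bounded_ops \<and>
     (\<forall>x y. cinner (blinfun_apply T x) y = cinner x (blinfun_apply S y))"
  proof (rule ex_ex1I[OF adj_exists[OF assms]])
    fix S S'
    assume "S \<in> bounded_ops \<and> (\<forall>x y. cinner (blinfun_apply T x) y = cinner x (blinfun_apply S y))"
      and "S' \<in> bounded_ops \<and> (\<forall>x y. cinner (blinfun_apply T x) y = cinner x (blinfun_apply S' y))"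
    then show "S = S'" by (intro blinfun_eqI cinner_eqI) simp
  qed
  from theI'[OF this] show "adj T \<in> bounded_ops"
    and "cinner (blinfun_apply T x) y = cinner x (blinfun_apply (adj T) y)"
    unfolding adj_def by blast+
qed


section \<open>Concrete C*-algebras and their representations\<close>

(* Not required to contain the identity operator. *)
definition cstar_subalgebra :: "('a::complex_hilbert \<Rightarrow>\<^sub>L 'a) set \<Rightarrow> bool" where
  "cstar_subalgebra A \<longleftrightarrow> A \<subseteq> bounded_ops \<and> 0 \<in> A \<and>
     (\<forall>S\<in>A. \<forall>T\<in>A. S + T \<in> A) \<and>
     (\<forall>c. \<forall>T\<in>A. scaleC_op c T \<in> A) \<and>
     (\<forall>S\<in>A. \<forall>T\<in>A. S o\<^sub>L T \<in> A) \<and>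
     (\<forall>T\<in>A. adj T \<in> A) \<and>
     closed A"

definition cstar_generated ::
    "('a::complex_hilbert \<Rightarrow>\<^sub>L 'a) set \<Rightarrow> ('a \<Rightarrow>\<^sub>L 'a) set" where
  "cstar_generated G = \<Inter>{A. cstar_subalgebra A \<and> G \<subseteq> A}"

(* Only the values of \<pi> on A matter. The last conjunct says that \<pi> is nondegenerate:
   the vectors \<pi>(a)x span a dense subspace. The real span suffices, since the set of
   these vectors is closed under complex scalar multiplication. If A contains the
   identity operator, nondegeneracy amounts to \<pi>(1) = 1. *)
definition representation ::
    "('a::complex_hilbert \<Rightarrow>\<^sub>L 'a) set \<Rightarrow>
     (('a \<Rightarrow>\<^sub>L 'a) \<Rightarrow> ('l::complex_hilbert \<Rightarrow>\<^sub>L 'l)) \<Rightarrow> bool" where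
  "representation A \<pi> \<longleftrightarrow> \<pi> ` A \<subseteq> bounded_ops \<and>
     (\<forall>S\<in>A. \<forall>T\<in>A. \<pi> (S + T) = \<pi> S + \<pi> T) \<and>
     (\<forall>c. \<forall>T\<in>A. \<pi> (scaleC_op c T) = scaleC_op c (\<pi> T)) \<and>
     (\<forall>S\<in>A. \<forall>T\<in>A. \<pi> (S o\<^sub>L T) = \<pi> S o\<^sub>L \<pi> T) \<and>
     (\<forall>T\<in>A. \<pi> (adj T) = adj (\<pi> T)) \<and>
     closure (span {blinfun_apply (\<pi> T) x | T x. T \<in> A}) = UNIV"

definition faithful_representation ::
    "('a::complex_hilbert \<Rightarrow>\<^sub>L 'a) set \<Rightarrow>
     (('a \<Rightarrow>\<^sub>L 'a) \<Rightarrow> ('l::complex_hilbert \<Rightarrow>\<^sub>L 'l)) \<Rightarrow> bool" where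
  "faithful_representation A \<pi> \<longleftrightarrow> representation A \<pi> \<and> inj_on \<pi> A"


section \<open>Unital completely positive maps\<close>

(* The n-by-n operator matrix (a i j) acts on the n-fold direct sum of the Hilbert
   space; positivity means that <a xi, xi> is real and nonnegative for all xi. *)
definition positive_op_matrix ::
    "nat \<Rightarrow> (nat \<Rightarrow> nat \<Rightarrow> ('a::complex_hilbert \<Rightarrow>\<^sub>L 'a)) \<Rightarrow> bool" where
  "positive_op_matrix n a \<longleftrightarrow>
     (\<forall>\<xi>::nat \<Rightarrow> 'a. (\<Sum>i<n. cinner (\<Sum>j<n. blinfun_apply (a i j) (\<xi> j)) (\<xi> i)) \<in> \<real>\<^sub>\<ge>\<^sub>0)"

definition completely_positive ::
    "(('a::complex_hilbert \<Rightarrow>\<^sub>L 'a) \<Rightarrow> ('a \<Rightarrow>\<^sub>L 'a)) \<Rightarrow> bool" where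
  "completely_positive \<phi> \<longleftrightarrow>
     (\<forall>n a. (\<forall>i<n. \<forall>j<n. a i j \<in> bounded_ops) \<longrightarrow> positive_op_matrix n a \<longrightarrow>
        positive_op_matrix n (\<lambda>i j. \<phi> (a i j)))"

definition ucp :: "(('a::complex_hilbert \<Rightarrow>\<^sub>L 'a) \<Rightarrow> ('a \<Rightarrow>\<^sub>L 'a)) \<Rightarrow> bool" where
  "ucp \<phi> \<longleftrightarrow> \<phi> ` bounded_ops \<subseteq> bounded_ops \<and>
     (\<forall>S\<in>bounded_ops. \<forall>T\<in>bounded_ops. \<phi> (S + T) = \<phi> S + \<phi> T) \<and>
     (\<forall>c. \<forall>T\<in>bounded_ops. \<phi> (scaleC_op c T) = scaleC_op c (\<phi> T)) \<and>
     \<phi> id_blinfun = id_blinfun \<and> completely_positive \<phi>"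


section \<open>Hyperrigidity\<close>

definition generating_set ::
    "('a::complex_hilbert \<Rightarrow>\<^sub>L 'a) set \<Rightarrow> ('a \<Rightarrow>\<^sub>L 'a) set \<Rightarrow> bool" where
  "generating_set A G \<longleftrightarrow> countable G \<and> G \<subseteq> bounded_ops \<and> cstar_generated G = A"

(* Hyperrigidity quantifies over all Hilbert spaces L, hence over types, which HOL
   cannot do inside a formula. The type of L is therefore a parameter: G is a hyperrigid
   generator iff hyperrigid TYPE('l) A G holds for every type 'l, so a single type at
   which it fails shows that G is not hyperrigid. *)
definition hyperrigid ::
    "'l::complex_hilbert itself \<Rightarrow>
     ('a::complex_hilbert \<Rightarrow>\<^sub>L 'a) set \<Rightarrow> ('a \<Rightarrow>\<^sub>L 'a) set \<Rightarrow> bool" where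
  "hyperrigid L A G \<longleftrightarrow> generating_set A G \<and>
     (\<forall>\<pi> :: ('a \<Rightarrow>\<^sub>L 'a) \<Rightarrow> ('l \<Rightarrow>\<^sub>L 'l). faithful_representation A \<pi> \<longrightarrow>
       (\<forall>\<phi> :: nat \<Rightarrow> ('l \<Rightarrow>\<^sub>L 'l) \<Rightarrow> ('l \<Rightarrow>\<^sub>L 'l). (\<forall>n. ucp (\<phi> n)) \<longrightarrow>
         (\<forall>g\<in>G. (\<lambda>n. norm (\<phi> n (\<pi> g) - \<pi> g)) \<longlonglongrightarrow> 0) \<longrightarrow>
         (\<forall>a\<in>A. (\<lambda>n. norm (\<phi> n (\<pi> a) - \<pi> a)) \<longlonglongrightarrow> 0)))"

end

theory Submission
  imports Defs
begin

text \<open>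
  Let \<open>W\<close> be the image of \<open>V\<close> in a faithful representation and let \<open>\<phi>\<^sub>n\<close> be UCP maps.
  The Cauchy--Schwarz inequality for the positive form
  \<open>(a, b) \<mapsto> \<phi>\<^sub>n(a\<^sup>* b) - \<phi>\<^sub>n(a)\<^sup>* \<phi>\<^sub>n(b)\<close> shows that if \<open>\<phi>\<^sub>n\<close> asymptotically fixes \<open>a\<close>
  and \<open>a\<^sup>* a\<close>, and also \<open>b\<close>, then it asymptotically fixes \<open>a\<^sup>* b\<close>. Since \<open>W\<^sup>* W = 1\<close> is fixed
  anyway, fixing \<open>W\<close> and \<open>W W\<^sup>*\<close> in the limit allows left multiplication by both \<open>W\<close> and \<open>W\<^sup>*\<close>,
  hence by the whole algebra. Without control of \<open>V V\<^sup>*\<close> this fails: the UCP map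
  \<open>T \<mapsto> V\<^sup>* T V\<close> fixes \<open>V\<close> but sends \<open>V V\<^sup>*\<close> to \<open>1\<close>.
\<close>

section \<open>The adjoint\<close>

text \<open>Makes the operators a Banach space, so that closed sets of them are complete and the
  fixed-point argument for square roots applies.\<close>

instance complex_hilbert \<subseteq> banach ..

lemma scaleC_diff_right: "c *\<^sub>C (x - y) = c *\<^sub>C x - c *\<^sub>C y"
  by (rule linear_diff[OF bounded_linear.linear[OF bounded_linear_scaleC_right]])

section \<open>Algebraic operations on complex-linear operators\<close>

lemma bounded_ops_zero_id [simp]: "0 \<in> bounded_ops" "id_blinfun \<in> bounded_ops"
  using scaleC_diff_right[of _ 0 0] by (auto simp: bounded_ops_def)

lemma blinfun_compose_id [simp]: "id_blinfun o\<^sub>L T = T" "T o\<^sub>L id_blinfun = T"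
  by (auto intro: blinfun_eqI)

lemma blinfun_compose_assoc: "(S o\<^sub>L T) o\<^sub>L U = S o\<^sub>L (T o\<^sub>L U)"
  by (auto intro: blinfun_eqI)

lemma scaleR_eq_scaleC_op: "r *\<^sub>R T = scaleC_op (complex_of_real r) T"
  by (rule blinfun_eqI) (simp add: scaleC_op.rep_eq blinfun.scaleR_left scaleC_of_real)

lemma bounded_ops_add [simp]: "S \<in> bounded_ops \<Longrightarrow> T \<in> bounded_ops \<Longrightarrow> S + T \<in> bounded_ops"
  by (simp add: bounded_ops_def blinfun.add_left scaleC_add_right)

lemma bounded_ops_diff [simp]: "S \<in> bounded_ops \<Longrightarrow> T \<in> bounded_ops \<Longrightarrow> S - T \<in> bounded_ops"
  by (simp add: bounded_ops_def blinfun.diff_left scaleC_diff_right)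

lemma bounded_ops_scaleC_op [simp]: "T \<in> bounded_ops \<Longrightarrow> scaleC_op c T \<in> bounded_ops"
  by (simp add: bounded_ops_def scaleC_op.rep_eq scaleC_scaleC mult.commute)

lemma bounded_ops_scaleR [simp]: "T \<in> bounded_ops \<Longrightarrow> r *\<^sub>R T \<in> bounded_ops"
  by (simp add: scaleR_eq_scaleC_op)

lemma bounded_ops_compose [simp]:
  "S \<in> bounded_ops \<Longrightarrow> T \<in> bounded_ops \<Longrightarrow> S o\<^sub>L T \<in> bounded_ops"
  by (simp add: bounded_ops_def)

lemma closed_bounded_ops: "closed bounded_ops"
proof -
  have "closed {T :: 'a \<Rightarrow>\<^sub>L 'a. T (c *\<^sub>C x) = c *\<^sub>C T x}" for c x
    by (intro closed_Collect_eq continuous_intros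
        bounded_linear.continuous_on[OF bounded_linear_scaleC_right])
  then show ?thesis
    unfolding bounded_ops_def by (intro closed_Collect_all)
qed

declare adj_bounded_ops [simp]

section \<open>Calculus of adjoints\<close>

lemma inner_adj: "T \<in> bounded_ops \<Longrightarrow> T x \<bullet> y = x \<bullet> adj T y"
  by (simp add: cinner_adj flip: Re_cinner)

lemma inner_adj': "T \<in> bounded_ops \<Longrightarrow> adj T x \<bullet> y = x \<bullet> T y"
  by (metis inner_adj inner_commute)

text \<open>The adjoint is known to exist and real inner products separate points, so the real
  identity determines it; complex linearity of \<open>S\<close> comes out as a consequence.\<close>

lemma adj_eqI:
  fixes S T :: "'a::complex_hilbert \<Rightarrow>\<^sub>L 'a"
  assumes "T \<in> bounded_ops" and "\<And>x y. T x \<bullet> y = x \<bullet> S y"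
  shows "adj T = S"
proof (rule blinfun_eqI)
  fix y
  have "\<forall>x. x \<bullet> adj T y = x \<bullet> S y" using assms by (simp flip: inner_adj)
  then show "adj T y = S y" by (simp only: vector_eq_ldot)
qed

lemma adj_adj [simp]: "T \<in> bounded_ops \<Longrightarrow> adj (adj T) = T"
  by (rule adj_eqI) (simp_all add: inner_adj')

lemma adj_id [simp]: "adj id_blinfun = id_blinfun"
  by (rule adj_eqI) simp_all

lemma adj_add: "S \<in> bounded_ops \<Longrightarrow> T \<in> bounded_ops \<Longrightarrow> adj (S + T) = adj S + adj T"
  by (rule adj_eqI) (simp_all add: blinfun.add_left inner_add inner_adj)

lemma adj_diff: "S \<in> bounded_ops \<Longrightarrow> T \<in> bounded_ops \<Longrightarrow> adj (S - T) = adj S - adj T"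
  by (rule adj_eqI) (simp_all add: blinfun.diff_left inner_diff inner_adj)

lemma adj_scaleR: "T \<in> bounded_ops \<Longrightarrow> adj (r *\<^sub>R T) = r *\<^sub>R adj T"
  by (rule adj_eqI) (simp_all add: blinfun.scaleR_left inner_adj)

lemma adj_zero [simp]: "adj 0 = 0"
  by (rule adj_eqI) simp_all

lemma adj_compose:
  "S \<in> bounded_ops \<Longrightarrow> T \<in> bounded_ops \<Longrightarrow> adj (S o\<^sub>L T) = adj T o\<^sub>L adj S"
  by (rule adj_eqI) (simp_all add: inner_adj)

lemma adj_scaleC_op:
  assumes "T \<in> bounded_ops"
  shows "adj (scaleC_op c T) = scaleC_op (cnj c) (adj T)"
  by (rule adj_eqI)
     (simp_all add: assms scaleC_op.rep_eq cinner_scaleC_left cinner_scaleC_right cinner_adj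
       flip: Re_cinner)

text \<open>Write the square of \<open>norm (adj T y)\<close> as the inner product of
  \<open>T (adj T y)\<close> with \<open>y\<close>, apply Cauchy-Schwarz and cancel one
  factor.\<close>

lemma norm_adj_le:
  assumes T: "T \<in> bounded_ops"
  shows "norm (adj T) \<le> norm T"
proof (rule norm_blinfun_bound)
  fix y
  have "norm (adj T y) * norm (adj T y) = T (adj T y) \<bullet> y"
    by (simp add: inner_adj[OF T] power2_norm_eq_inner flip: power2_eq_square)
  also have "\<dots> \<le> norm (T (adj T y)) * norm y" by (rule norm_cauchy_schwarz)
  also have "\<dots> \<le> norm T * norm (adj T y) * norm y"
    by (intro mult_right_mono norm_blinfun) simp
  finally have "norm (adj T y) * norm (adj T y) \<le> norm (adj T y) * (norm T * norm y)"
    by (simp only: mult_ac)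
  then show "norm (adj T y) \<le> norm T * norm y"
    by (cases "adj T y = 0") auto
qed simp

lemma tendsto_adj:
  assumes f: "(f \<longlongrightarrow> T) F" and "\<And>n. f n \<in> bounded_ops" and T: "T \<in> bounded_ops"
  shows "((\<lambda>n. adj (f n)) \<longlongrightarrow> adj T) F"
proof (rule Lim_transform_bound[of _ "\<lambda>n. f n - T", THEN LIM_zero_cancel])
  show "((\<lambda>n. f n - T) \<longlongrightarrow> 0) F" using f by (rule LIM_zero)
  show "\<forall>\<^sub>F n in F. norm (adj (f n) - adj T) \<le> norm (f n - T)"
    using assms by (simp add: norm_adj_le flip: adj_diff)
qed

lemmas tendsto_blinfun_compose = bounded_bilinear.tendsto[OF bounded_bilinear_blinfun_compose]

lemmas blinfun_compose_simps =
  bounded_bilinear.add_left[OF bounded_bilinear_blinfun_compose]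
  bounded_bilinear.add_right[OF bounded_bilinear_blinfun_compose]
  bounded_bilinear.diff_left[OF bounded_bilinear_blinfun_compose]
  bounded_bilinear.diff_right[OF bounded_bilinear_blinfun_compose]
  bounded_bilinear.scaleR_left[OF bounded_bilinear_blinfun_compose]
  bounded_bilinear.scaleR_right[OF bounded_bilinear_blinfun_compose]

text \<open>Polarization: preserved norms of \<open>x\<close>, \<open>y\<close> and
  \<open>x + y\<close> give preserved inner products.\<close>

lemma isometry_adj_compose:
  assumes "is_isometry V"
  shows "adj V o\<^sub>L V = id_blinfun"
proof (rule blinfun_eqI)
  fix y
  have V: "V \<in> bounded_ops" and n: "\<And>x. norm (V x) = norm x"
    using assms by (auto simp: is_isometry_def)
  have "x \<bullet> adj V (V y) = x \<bullet> y" for x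
  proof -
    have "V x \<bullet> V x = x \<bullet> x" for x by (metis n power2_norm_eq_inner)
    from this[of "x + y"] this[of x] this[of y] show ?thesis
      by (simp add: blinfun.add_right inner_add inner_commute flip: inner_adj[OF V])
  qed
  then have "\<forall>x. x \<bullet> adj V (V y) = x \<bullet> y" by blast
  then show "(adj V o\<^sub>L V) y = id_blinfun y" by (simp only: vector_eq_ldot) simp
qed


section \<open>Representations are contractive\<close>

lemma cstar_subalgebraD:
  assumes "cstar_subalgebra A"
  shows "T \<in> A \<Longrightarrow> T \<in> bounded_ops" "0 \<in> A"
    "S \<in> A \<Longrightarrow> T \<in> A \<Longrightarrow> S + T \<in> A" "T \<in> A \<Longrightarrow> scaleC_op c T \<in> A"
    "T \<in> A \<Longrightarrow> r *\<^sub>R T \<in> A" "S \<in> A \<Longrightarrow> T \<in> A \<Longrightarrow> S - T \<in> A"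
    "S \<in> A \<Longrightarrow> T \<in> A \<Longrightarrow> S o\<^sub>L T \<in> A" "T \<in> A \<Longrightarrow> adj T \<in> A" "closed A"
proof -
  show *: "T \<in> A \<Longrightarrow> r *\<^sub>R T \<in> A" for r T
    using assms by (auto simp: cstar_subalgebra_def scaleR_eq_scaleC_op)
  show "S \<in> A \<Longrightarrow> T \<in> A \<Longrightarrow> S - T \<in> A"
    using *[of T "-1"] assms unfolding cstar_subalgebra_def
    by (metis scaleR_minus1_left uminus_add_conv_diff add.commute)
qed (use assms in \<open>auto simp: cstar_subalgebra_def\<close>)

lemma cstar_subalgebra_bounded_ops: "cstar_subalgebra bounded_ops"
  by (simp add: cstar_subalgebra_def closed_bounded_ops)

lemma cstar_subalgebra_generated:
  assumes "G \<subseteq> bounded_ops"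
  shows "cstar_subalgebra (cstar_generated G)"
proof -
  let ?F = "{A. cstar_subalgebra A \<and> G \<subseteq> A}"
  have "closed (\<Inter>?F)" by (rule closed_Inter) (auto simp: cstar_subalgebra_def)
  \<comment> \<open>The family is nonempty, since \<open>bounded_ops\<close> belongs to it;
    otherwise the intersection would be all real-linear operators.\<close>
  moreover have "\<Inter>?F \<subseteq> bounded_ops" using assms cstar_subalgebra_bounded_ops by blast
  ultimately show ?thesis
    unfolding cstar_generated_def cstar_subalgebra_def[of "\<Inter>?F"]
    by (auto intro: cstar_subalgebraD)
qed

lemma cstar_generated_superset: "G \<subseteq> cstar_generated G"
  by (auto simp: cstar_generated_def)

lemma cstar_generated_least: "cstar_subalgebra A \<Longrightarrow> G \<subseteq> A \<Longrightarrow> cstar_generated G \<subseteq> A"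
  by (auto simp: cstar_generated_def)

text \<open>With \<^term>\<open>s = 1 - y\<close>, the equation \<^term>\<open>s\<^sup>2 = 1 - x\<close> reads \<^term>\<open>y = (x + y\<^sup>2) / 2\<close>, whose
  right-hand side is a contraction of the ball of radius \<^term>\<open>norm x\<close>.\<close>

lemma cstar_sqrt_one_minus:
  assumes A: "cstar_subalgebra A" and x: "x \<in> A" "adj x = x" and less: "norm x < 1"
  obtains y where "y \<in> A" "adj y = y" "(id_blinfun - y) o\<^sub>L (id_blinfun - y) = id_blinfun - x"
proof -
  note [simp] = cstar_subalgebraD(1)[OF A]
  define f where "f y = (1/2) *\<^sub>R (x + (y o\<^sub>L y))" for y
  \<comment> \<open>Restricting to self-adjoint elements of \<open>A\<close> passes both properties
    on to the fixed point.\<close>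
  define B where "B = {y \<in> A. adj y = y \<and> norm y \<le> norm x}"
  have "closed B"
  proof (rule closed_sequential_limits[THEN iffD2], intro allI impI)
    fix g l assume g: "(\<forall>n. g n \<in> B) \<and> g \<longlonglongrightarrow> l"
    then have l: "l \<in> A"
      using cstar_subalgebraD(9)[OF A] closed_sequentially by (auto simp: B_def)
    have "(\<lambda>n. adj (g n)) \<longlonglongrightarrow> adj l"
      using g l by (intro tendsto_adj) (auto simp: B_def)
    then have "adj l = l"
      using g LIMSEQ_unique by (auto simp: B_def)
    moreover have "norm l \<le> norm x"
      by (rule LIMSEQ_le_const2[OF tendsto_norm[of g]]) (use g in \<open>auto simp: B_def\<close>)
    ultimately show "l \<in> B" using l by (simp add: B_def)
  qed
  then have "complete B" by (simp add: complete_eq_closed)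
  moreover have "B \<noteq> {}" using x by (auto simp: B_def)
  moreover have "f ` B \<subseteq> B"
  proof safe
    fix y assume y: "y \<in> B"
    then have yA: "y \<in> A" and adj: "adj y = y" and n: "norm y \<le> norm x" by (auto simp: B_def)
    have "norm (f y) \<le> (norm x + norm y * norm y) / 2"
      unfolding f_def using norm_triangle_ineq[of x "y o\<^sub>L y"] norm_blinfun_compose[of y y] by simp
    also have "\<dots> \<le> (norm x + norm x * 1) / 2"
      using n less by (intro divide_right_mono add_left_mono mult_mono) auto
    finally have "norm (f y) \<le> norm x" by simp
    then show "f y \<in> B"
      using yA x adj by (simp add: B_def f_def adj_scaleR adj_add adj_compose cstar_subalgebraD[OF A])
  qed
  moreover have "\<forall>y\<in>B. \<forall>z\<in>B. dist (f y) (f z) \<le> norm x * dist y z"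
  proof safe
    fix y z assume "y \<in> B" "z \<in> B"
    then have n: "norm y \<le> norm x" "norm z \<le> norm x" by (auto simp: B_def)
    \<comment> \<open>This splitting of the difference of squares is valid without
      commutativity.\<close>
    have "f y - f z = (1/2) *\<^sub>R ((y o\<^sub>L (y - z)) + ((y - z) o\<^sub>L z))"
      by (simp add: f_def blinfun_compose_simps algebra_simps)
    also have "norm \<dots> \<le> (norm (y o\<^sub>L (y - z)) + norm ((y - z) o\<^sub>L z)) / 2"
      using norm_triangle_ineq[of "y o\<^sub>L (y - z)" "(y - z) o\<^sub>L z"] by simp
    also have "\<dots> \<le> (norm y * norm (y - z) + norm (y - z) * norm z) / 2"
      by (intro divide_right_mono add_mono norm_blinfun_compose) simp
    also have "\<dots> \<le> (norm x * norm (y - z) + norm (y - z) * norm x) / 2"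
      using n by (intro divide_right_mono add_mono mult_mono) auto
    finally show "dist (f y) (f z) \<le> norm x * dist y z" by (simp add: dist_norm)
  qed
  ultimately have "\<exists>!y\<in>B. f y = y"
    using less by (intro Banach_fix) auto
  then obtain y where y: "y \<in> B" "f y = y" by blast
  have "x + (y o\<^sub>L y) = 2 *\<^sub>R f y" by (simp add: f_def)
  then have "x + (y o\<^sub>L y) = y + y" by (simp add: y scaleR_2)
  then have "(id_blinfun - y) o\<^sub>L (id_blinfun - y) = id_blinfun - x"
    by (simp add: blinfun_compose_simps algebra_simps)
  with y show thesis by (intro that[of y]) (auto simp: B_def)
qed

lemma representationD:
  assumes "representation A \<pi>"
  shows "T \<in> A \<Longrightarrow> \<pi> T \<in> bounded_ops"
    "S \<in> A \<Longrightarrow> T \<in> A \<Longrightarrow> \<pi> (S + T) = \<pi> S + \<pi> T"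
    "T \<in> A \<Longrightarrow> \<pi> (scaleC_op c T) = scaleC_op c (\<pi> T)"
    "T \<in> A \<Longrightarrow> \<pi> (r *\<^sub>R T) = r *\<^sub>R \<pi> T"
    "S \<in> A \<Longrightarrow> T \<in> A \<Longrightarrow> \<pi> (S o\<^sub>L T) = \<pi> S o\<^sub>L \<pi> T"
    "T \<in> A \<Longrightarrow> \<pi> (adj T) = adj (\<pi> T)"
  using assms by (auto simp: representation_def scaleR_eq_scaleC_op)

lemma representation_diff:
  assumes A: "cstar_subalgebra A" and \<pi>: "representation A \<pi>" and ST: "S \<in> A" "T \<in> A"
  shows "\<pi> (S - T) = \<pi> S - \<pi> T"
  using representationD(2)[OF \<pi>, of "S - T" T] ST cstar_subalgebraD(6)[OF A]
  by (simp add: eq_diff_eq)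

text \<open>\<open>\<pi> id_blinfun\<close> fixes every vector \<open>\<pi> T x\<close>. Its fixed
  vectors form a closed subspace, which is everything by nondegeneracy.\<close>

lemma representation_id:
  assumes \<pi>: "representation A \<pi>" and id: "id_blinfun \<in> A"
  shows "\<pi> id_blinfun = id_blinfun"
proof -
  let ?X = "{blinfun_apply (\<pi> T) x | T x. T \<in> A}"
  have dense: "closure (span ?X) = UNIV" using \<pi> by (simp add: representation_def)
  have "subspace {x. \<pi> id_blinfun x = x}"
    by (auto simp: subspace_def blinfun.add_right blinfun.scaleR_right)
  moreover have "?X \<subseteq> {x. \<pi> id_blinfun x = x}"
  proof safe
    fix T x assume "T \<in> A"
    then have "\<pi> T = \<pi> id_blinfun o\<^sub>L \<pi> T"
      using representationD(5)[OF \<pi> id, of T] by simp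
    then show "\<pi> id_blinfun (\<pi> T x) = \<pi> T x" by (metis blinfun_apply_blinfun_compose)
  qed
  ultimately have "span ?X \<subseteq> {x. \<pi> id_blinfun x = x}" by (rule span_minimal[rotated])
  moreover have "closed {x. \<pi> id_blinfun x = x}"
    by (intro closed_Collect_eq continuous_intros)
  ultimately have "{x. \<pi> id_blinfun x = x} = UNIV"
    using closure_minimal dense by blast
  then show ?thesis by (intro blinfun_eqI) auto
qed

text \<open>For \<open>norm S < 1\<close> the identity minus \<open>adj S o\<^sub>L S\<close> is the
  square of a self-adjoint element of \<open>A\<close>, so its image is positive and
  \<open>\<pi> S\<close> is a contraction. The continuity of \<open>\<pi>\<close> is needed later to
  pass to norm limits of generators.\<close>

lemma representation_norm_le:
  assumes A: "cstar_subalgebra A" and \<pi>: "representation A \<pi>"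
    and id: "id_blinfun \<in> A" and T: "T \<in> A"
  shows "norm (\<pi> T) \<le> norm T"
proof -
  note [simp] = cstar_subalgebraD[OF A] representationD[OF \<pi>] representation_diff[OF A \<pi>]
    representation_id[OF \<pi> id] id
  have contr: "norm (\<pi> S) \<le> 1" if S: "S \<in> A" "norm S < 1" for S
  proof -
    let ?x = "adj S o\<^sub>L S"
    have "norm ?x \<le> norm (adj S) * norm S" by (rule norm_blinfun_compose)
    also have "\<dots> \<le> 1 * norm S"
      using norm_adj_le[of S] S by (intro mult_right_mono) auto
    finally have "norm ?x < 1" using S by simp
    moreover have "?x \<in> A" "adj ?x = ?x" using S by (simp_all add: adj_compose)
    ultimately obtain y where y: "y \<in> A" "adj y = y"
      and sq: "(id_blinfun - y) o\<^sub>L (id_blinfun - y) = id_blinfun - ?x"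
      using cstar_sqrt_one_minus[OF A] by blast
    define s where "s = id_blinfun - y"
    have s: "s \<in> A" "adj s = s" using y by (auto simp: s_def adj_diff)
    have "id_blinfun - ?x = adj s o\<^sub>L s" using sq s by (simp add: s_def)
    then have "\<pi> (id_blinfun - ?x) = \<pi> (adj s o\<^sub>L s)" by simp
    then have eq: "id_blinfun - (adj (\<pi> S) o\<^sub>L \<pi> S) = adj (\<pi> s) o\<^sub>L \<pi> s"
      using S s(1) by (simp del: s(2))
    show ?thesis
    proof (rule norm_blinfun_bound)
      fix v
      have "(id_blinfun - (adj (\<pi> S) o\<^sub>L \<pi> S)) v \<bullet> v = (adj (\<pi> s) o\<^sub>L \<pi> s) v \<bullet> v"
        by (simp only: eq)
      then have "v \<bullet> v - \<pi> S v \<bullet> \<pi> S v = \<pi> s v \<bullet> \<pi> s v"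
        using S s(1) by (simp add: blinfun.diff_left inner_diff inner_adj')
      then have "(norm (\<pi> S v))\<^sup>2 \<le> (norm v)\<^sup>2"
        unfolding power2_norm_eq_inner using inner_ge_zero[of "\<pi> s v"] by linarith
      then show "norm (\<pi> S v) \<le> 1 * norm v"
        using power2_le_imp_le[OF _ norm_ge_zero[of v]] by simp
    qed simp
  qed
  \<comment> \<open>The square root demands norm strictly below 1, so \<open>T\<close> is scaled by
    any \<open>c\<close> above its norm, and \<open>c\<close> then decreases to
    \<open>norm T\<close>.\<close>
  have "norm (\<pi> T) \<le> c" if c: "c > norm T" for c
  proof -
    have "c > 0" using c norm_ge_zero[of T] by linarith
    have "norm (\<pi> ((1/c) *\<^sub>R T)) \<le> 1"
      using \<open>c > 0\<close> c T by (intro contr) (auto simp: field_simps)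
    then show ?thesis using \<open>c > 0\<close> T by (simp add: field_simps)
  qed
  then show ?thesis by (rule dense_ge)
qed


section \<open>Unital completely positive maps\<close>

lemma cinner_add_right: "cinner x (y + z) = cinner x y + cinner x z"
  by (simp only: cinner_commute[of x] cinner_add_left complex_cnj_add)

lemma cinner_zero [simp]: "cinner 0 x = 0" "cinner x 0 = 0"
  using cinner_add_left[of 0 0 x] cinner_add_right[of x 0 0] by simp_all

lemma cinner_sum_right: "cinner x (sum f I) = (\<Sum>i\<in>I. cinner x (f i))"
  by (induction I rule: infinite_finite_induct) (simp_all add: cinner_add_right)

text \<open>The quadratic form of a Gram matrix collapses to the squared norm of a single vector,
  the sum of the \<open>R j (\<xi> j)\<close>.\<close>

lemma positive_op_matrix_gram:
  assumes "\<And>i. i < n \<Longrightarrow> R i \<in> bounded_ops"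
  shows "positive_op_matrix n (\<lambda>i j. adj (R i) o\<^sub>L R j)"
  unfolding positive_op_matrix_def
proof
  fix \<xi> :: "nat \<Rightarrow> 'a"
  define u where "u = (\<Sum>j<n. R j (\<xi> j))"
  have "(\<Sum>i<n. cinner (\<Sum>j<n. (adj (R i) o\<^sub>L R j) (\<xi> j)) (\<xi> i)) = (\<Sum>i<n. cinner u (R i (\<xi> i)))"
    using assms by (intro sum.cong)
      (auto simp: u_def cinner_adj[of "adj (R _)"] simp flip: blinfun.sum_right)
  also have "\<dots> = complex_of_real ((norm u)\<^sup>2)"
    by (simp only: u_def flip: cinner_sum_right cinner_self)
  finally show "(\<Sum>i<n. cinner (\<Sum>j<n. (adj (R i) o\<^sub>L R j) (\<xi> j)) (\<xi> i)) \<in> \<real>\<^sub>\<ge>\<^sub>0"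
    by simp
qed

section \<open>Consequences of complete positivity for a single map\<close>

context
  fixes \<phi> :: "('a::complex_hilbert \<Rightarrow>\<^sub>L 'a) \<Rightarrow> ('a \<Rightarrow>\<^sub>L 'a)"
  assumes ucp: "ucp \<phi>"
begin

lemma ucpD [simp]:
  shows "T \<in> bounded_ops \<Longrightarrow> \<phi> T \<in> bounded_ops"
    "S \<in> bounded_ops \<Longrightarrow> T \<in> bounded_ops \<Longrightarrow> \<phi> (S + T) = \<phi> S + \<phi> T"
    "T \<in> bounded_ops \<Longrightarrow> \<phi> (scaleC_op c T) = scaleC_op c (\<phi> T)"
    "\<phi> id_blinfun = id_blinfun"
  using ucp by (auto simp: ucp_def)

lemma ucp_scaleR: "T \<in> bounded_ops \<Longrightarrow> \<phi> (r *\<^sub>R T) = r *\<^sub>R \<phi> T"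
  by (simp add: scaleR_eq_scaleC_op)

lemma ucp_diff:
  assumes "S \<in> bounded_ops" "T \<in> bounded_ops"
  shows "\<phi> (S - T) = \<phi> S - \<phi> T"
  using ucpD(2)[of "S - T" T] assms by (simp add: eq_diff_eq)

lemma ucp_positive_op_matrix:
  assumes "positive_op_matrix n a" and "\<And>i j. i < n \<Longrightarrow> j < n \<Longrightarrow> a i j \<in> bounded_ops"
  shows "positive_op_matrix n (\<lambda>i j. \<phi> (a i j))"
  using ucp assms by (simp add: ucp_def completely_positive_def)

lemma ucp_gram:
  fixes R :: "nat \<Rightarrow> ('a \<Rightarrow>\<^sub>L 'a)"
  assumes "\<And>i. i < n \<Longrightarrow> R i \<in> bounded_ops"
  shows "(\<Sum>i<n. cinner (\<Sum>j<n. \<phi> (adj (R i) o\<^sub>L R j) (\<xi> j)) (\<xi> i)) \<in> \<real>\<^sub>\<ge>\<^sub>0"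
proof -
  have "positive_op_matrix n (\<lambda>i j. \<phi> (adj (R i) o\<^sub>L R j))"
    by (intro ucp_positive_op_matrix positive_op_matrix_gram) (simp_all add: assms)
  then show ?thesis by (simp add: positive_op_matrix_def)
qed

lemma ucp_gram1:
  assumes "a \<in> bounded_ops"
  shows "cinner (\<phi> (adj a o\<^sub>L a) x) x \<in> \<real>\<^sub>\<ge>\<^sub>0"
  using ucp_gram[of "Suc 0" "\<lambda>_. a" "\<lambda>_. x"] assms by simp

text \<open>The form of the Gram matrix of \<open>(id_blinfun, a)\<close> is real, and so are its
  diagonal terms; hence the two off-diagonal terms have a real sum.\<close>

lemma ucp_adj:
  assumes a: "a \<in> bounded_ops"
  shows "\<phi> (adj a) = adj (\<phi> a)"
proof -
  have real: "cinner (\<phi> a x) y + cinner (\<phi> (adj a) y) x \<in> \<real>" for x y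
  proof -
    let ?R = "\<lambda>i::nat. if i = 0 then id_blinfun else a"
    have "(\<Sum>i<2. cinner (\<Sum>j<2. \<phi> (adj (?R i) o\<^sub>L ?R j) (if j = 0 then y else x))
        (if i = 0 then y else x)) \<in> \<real>\<^sub>\<ge>\<^sub>0"
      by (rule ucp_gram) (simp add: a)
    then have "cinner y y + cinner (\<phi> a x) y + cinner (\<phi> (adj a) y) x
        + cinner (\<phi> (adj a o\<^sub>L a) x) x \<in> \<real>\<^sub>\<ge>\<^sub>0"
      by (simp add: numeral_2_eq_2 cinner_add_left add_ac)
    moreover note ucp_gram1[OF a, of x]
    moreover have "Im (cinner y y) = 0" by (simp add: cinner_self)
    ultimately show ?thesis
      by (auto simp: complex_is_Real_iff complex_nonneg_Reals_iff)
  qed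
  have "adj (\<phi> a) = \<phi> (adj a)"
  proof (rule adj_eqI)
    fix x y
    \<comment> \<open>Replacing \<open>x\<close> by \<open>\<i> *\<^sub>C x\<close> turns the
      vanishing imaginary part of the sum into equality of the two real parts.\<close>
    have "Re (cinner (\<phi> a x) y) = Re (cinner (\<phi> (adj a) y) x)"
      using real[of "\<i> *\<^sub>C x" y] a ucpD(1)[OF a]
      by (simp add: bounded_ops_def cinner_scaleC_left cinner_scaleC_right complex_is_Real_iff)
    then show "\<phi> a x \<bullet> y = x \<bullet> \<phi> (adj a) y"
      by (simp add: Re_cinner inner_commute)
  qed (use a in simp)
  then show ?thesis by simp
qed

text \<open>Complete positivity for the Gram matrix of \<^term>\<open>(1, a, b)\<close>, tested on the vector
  \<^term>\<open>(- \<phi> a x - \<phi> b y, x, y)\<close>: the choice of the first entry produces the Schur complement.\<close>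

lemma ucp_schur:
  assumes a: "a \<in> bounded_ops" and b: "b \<in> bounded_ops"
  shows "(norm (\<phi> a x + \<phi> b y))\<^sup>2 \<le>
    \<phi> (adj a o\<^sub>L a) x \<bullet> x + 2 * (\<phi> (adj a o\<^sub>L b) y \<bullet> x) + \<phi> (adj b o\<^sub>L b) y \<bullet> y"
proof -
  define u where "u = \<phi> a x + \<phi> b y"
  let ?R = "\<lambda>i::nat. if i = 0 then id_blinfun else if i = 1 then a else b"
  let ?\<xi> = "\<lambda>i::nat. if i = 0 then - u else if i = 1 then x else y"
  have "(\<Sum>i<3. cinner (\<Sum>j<3. \<phi> (adj (?R i) o\<^sub>L ?R j) (?\<xi> j)) (?\<xi> i)) \<in> \<real>\<^sub>\<ge>\<^sub>0"
    by (rule ucp_gram) (simp add: a b)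
  then have "0 \<le> Re (\<Sum>i<3. cinner (\<Sum>j<3. \<phi> (adj (?R i) o\<^sub>L ?R j) (?\<xi> j)) (?\<xi> i))"
    by (auto simp: complex_nonneg_Reals_iff)
  then have *: "0 \<le> (- u + \<phi> a x + \<phi> b y) \<bullet> (- u)
     + (\<phi> (adj a) (- u) + \<phi> (adj a o\<^sub>L a) x + \<phi> (adj a o\<^sub>L b) y) \<bullet> x
     + (\<phi> (adj b) (- u) + \<phi> (adj b o\<^sub>L a) x + \<phi> (adj b o\<^sub>L b) y) \<bullet> y"
    by (simp add: numeral_3_eq_3 Re_cinner)
  \<comment> \<open>The two cross terms agree because \<open>\<phi>\<close> preserves adjoints,
    whence the factor 2 in the claim.\<close>
  have ba: "\<phi> (adj b o\<^sub>L a) x \<bullet> y = \<phi> (adj a o\<^sub>L b) y \<bullet> x"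
    using ucp_adj[of "adj a o\<^sub>L b"] a b by (simp add: adj_compose inner_adj') (rule inner_commute)
  \<comment> \<open>The first row vanishes by the choice of \<open>u\<close>; the other terms
    containing \<open>u\<close> add up to minus its squared norm.\<close>
  have "\<phi> (adj a) u \<bullet> x + \<phi> (adj b) u \<bullet> y = u \<bullet> u"
    using a b by (simp add: ucp_adj inner_adj' u_def inner_add)
  moreover have "- u + \<phi> a x + \<phi> b y = 0" by (simp add: u_def)
  ultimately show ?thesis
    using * ba unfolding u_def[symmetric] power2_norm_eq_inner
    by (simp add: blinfun.minus_right inner_add_left inner_diff_left)
qed

text \<open>Positivity gives \<open>\<phi> (adj a o\<^sub>L a)\<close> the upper bound
  \<open>(norm a)\<^sup>2\<close>, and the Kadison-Schwarz inequality transfers this bound to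
  \<open>\<phi> a\<close>.\<close>

lemma ucp_norm_le:
  assumes a: "a \<in> bounded_ops"
  shows "norm (\<phi> a) \<le> norm a"
proof (rule norm_blinfun_bound)
  fix x
  let ?r = "(norm a)\<^sup>2"
  define T where "T = ?r *\<^sub>R id_blinfun - (adj a o\<^sub>L a)"
  have T: "T \<in> bounded_ops" using a by (simp add: T_def)
  have "positive_op_matrix (Suc 0) (\<lambda>i j. T)"
    unfolding positive_op_matrix_def
  proof
    fix \<xi> :: "nat \<Rightarrow> 'a"
    let ?x = "\<xi> 0"
    \<comment> \<open>\<open>positive_op_matrix\<close> also asks for a real value; self-adjointness
      supplies that.\<close>
    have adjT: "adj T = T" using a by (simp add: T_def adj_diff adj_scaleR adj_compose)
    have "Im (cinner (T ?x) ?x) = 0"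
      using cinner_adj[OF T, of ?x ?x] cinner_commute[of ?x "T ?x"] adjT
      by (metis complex_cnj_cancel_iff Reals_cnj_iff complex_is_Real_iff)
    moreover have "0 \<le> T ?x \<bullet> ?x"
    proof -
      have "(norm (a ?x))\<^sup>2 \<le> (norm a * norm ?x)\<^sup>2" by (intro power_mono norm_blinfun) simp
      then show ?thesis
        by (simp add: T_def blinfun.diff_left blinfun.scaleR_left inner_diff inner_adj'[OF a]
            power_mult_distrib power2_norm_eq_inner)
    qed
    ultimately show "(\<Sum>i<Suc 0. cinner (\<Sum>j<Suc 0. T (\<xi> j)) (\<xi> i)) \<in> \<real>\<^sub>\<ge>\<^sub>0"
      by (simp add: complex_nonneg_Reals_iff Re_cinner)
  qed
  then have "positive_op_matrix (Suc 0) (\<lambda>i j. \<phi> T)"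
    by (rule ucp_positive_op_matrix) (rule T)
  from this[unfolded positive_op_matrix_def, rule_format, of "\<lambda>_. x"]
  have "cinner (\<phi> T x) x \<in> \<real>\<^sub>\<ge>\<^sub>0" by simp
  then have "0 \<le> \<phi> T x \<bullet> x" by (simp add: complex_nonneg_Reals_iff Re_cinner)
  then have "\<phi> (adj a o\<^sub>L a) x \<bullet> x \<le> ?r * (norm x)\<^sup>2"
    using a by (simp add: T_def ucp_diff ucp_scaleR blinfun.diff_left blinfun.scaleR_left
        inner_diff power2_norm_eq_inner)
  \<comment> \<open>Kadison-Schwarz is the case of \<open>ucp_schur\<close> with second vector
    0.\<close>
  moreover have "(norm (\<phi> a x))\<^sup>2 \<le> \<phi> (adj a o\<^sub>L a) x \<bullet> x"
    using ucp_schur[OF a a, of x 0] by simp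
  ultimately have "(norm (\<phi> a x))\<^sup>2 \<le> (norm a * norm x)\<^sup>2" by (simp add: power_mult_distrib)
  then show "norm (\<phi> a x) \<le> norm a * norm x" by (rule power2_le_imp_le) simp
qed simp

text \<open>\<open>ucp_schur\<close> says that the quadratic form with diagonal blocks
  \<open>P\<close>, \<open>Q\<close> and off-diagonal block \<open>E\<close> is nonnegative.
  Minimizing in the first vector bounds \<open>E\<close>.\<close>

lemma ucp_cauchy_schwarz:
  assumes a: "a \<in> bounded_ops" and b: "b \<in> bounded_ops"
  shows "(norm (\<phi> (adj a o\<^sub>L b) - (adj (\<phi> a) o\<^sub>L \<phi> b)))\<^sup>2 \<le>
    norm (\<phi> (adj a o\<^sub>L a) - (adj (\<phi> a) o\<^sub>L \<phi> a)) * norm (\<phi> (adj b o\<^sub>L b) - (adj (\<phi> b) o\<^sub>L \<phi> b))"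
proof -
  define E where "E = \<phi> (adj a o\<^sub>L b) - (adj (\<phi> a) o\<^sub>L \<phi> b)"
  define P where "P = \<phi> (adj a o\<^sub>L a) - (adj (\<phi> a) o\<^sub>L \<phi> a)"
  define Q where "Q = \<phi> (adj b o\<^sub>L b) - (adj (\<phi> b) o\<^sub>L \<phi> b)"
  have form: "0 \<le> P x \<bullet> x + 2 * (E y \<bullet> x) + Q y \<bullet> y" for x y
    using ucp_schur[OF a b, of x y] a b
    by (simp add: P_def Q_def E_def blinfun.diff_left inner_diff inner_adj' power2_norm_eq_inner
        inner_add inner_commute[of "\<phi> a x" "\<phi> b y"])
  have bound: "P x \<bullet> x \<le> norm P * (norm x)\<^sup>2" for P :: "'a \<Rightarrow>\<^sub>L 'a" and x
  proof -
    have "P x \<bullet> x \<le> norm (P x) * norm x" by (rule norm_cauchy_schwarz)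
    also have "\<dots> \<le> norm P * norm x * norm x" by (intro mult_right_mono norm_blinfun) simp
    finally show ?thesis by (simp add: power2_eq_square)
  qed
  \<comment> \<open>\<open>\<delta>\<close> replaces \<open>norm P\<close>, which may be 0 and could
    not be divided by; a limit from the right restores it at the end.\<close>
  have est: "(norm E)\<^sup>2 \<le> \<delta> * norm Q" if \<delta>: "\<delta> > norm P" for \<delta>
  proof -
    have pos: "\<delta> > 0" using \<delta> norm_ge_zero[of P] by linarith
    have "norm E \<le> sqrt (\<delta> * norm Q)"
    proof (rule norm_blinfun_bound)
      fix y
      let ?e = "(norm (E y))\<^sup>2" and ?t = "1 / \<delta>"
      \<comment> \<open>Among multiples of \<open>E y\<close>, this one minimizes the upper bound
        for the form once \<open>norm P\<close> is replaced by \<open>\<delta>\<close>.\<close>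
      let ?x = "(- ?t) *\<^sub>R E y"
      have "0 \<le> norm P * (norm ?x)\<^sup>2 + 2 * (E y \<bullet> ?x) + norm Q * (norm y)\<^sup>2"
        using form[of ?x y] bound[of P ?x] bound[of Q y] by linarith
      also have "norm P * (norm ?x)\<^sup>2 \<le> \<delta> * (norm ?x)\<^sup>2"
        using \<delta> by (intro mult_right_mono) auto
      also have "\<delta> * (norm ?x)\<^sup>2 = ?e / \<delta>"
        using pos by (simp add: power_mult_distrib power2_eq_square)
      also have "E y \<bullet> ?x = - (?e / \<delta>)"
        by (simp add: power2_norm_eq_inner)
      finally have "?e / \<delta> \<le> norm Q * (norm y)\<^sup>2" by simp
      then have "?e \<le> (\<delta> * norm Q) * (norm y)\<^sup>2"
        using pos by (simp add: field_simps)
      also have "\<dots> = (sqrt (\<delta> * norm Q) * norm y)\<^sup>2"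
        using pos by (simp add: power_mult_distrib)
      finally show "norm (E y) \<le> sqrt (\<delta> * norm Q) * norm y"
        by (rule power2_le_imp_le) (use pos in simp)
    qed (use pos in simp)
    then have "(norm E)\<^sup>2 \<le> (sqrt (\<delta> * norm Q))\<^sup>2" by (intro power_mono) auto
    then show ?thesis using pos by simp
  qed
  have "(norm E)\<^sup>2 \<le> norm P * norm Q"
  proof (rule tendsto_lowerbound)
    show "((\<lambda>\<delta>. \<delta> * norm Q) \<longlongrightarrow> norm P * norm Q) (at_right (norm P))"
      by (intro tendsto_intros)
    show "\<forall>\<^sub>F \<delta> in at_right (norm P). (norm E)\<^sup>2 \<le> \<delta> * norm Q"
      using est by (auto simp: eventually_at_filter)
  qed simp
  then show ?thesis by (simp only: E_def P_def Q_def)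
qed

end

text \<open>The form of the new matrix at \<open>\<xi>\<close> is that of the old one at the vectors
  \<open>V (\<xi> i)\<close>; the map is unital because \<open>V\<close> is isometric. It serves as
  the counterexample for \<open>{V}\<close>.\<close>

lemma ucp_conjugate_isometry:
  assumes V: "is_isometry V"
  shows "ucp (\<lambda>T. adj V o\<^sub>L (T o\<^sub>L V))"
proof -
  have Vb: "V \<in> bounded_ops" using V by (simp add: is_isometry_def)
  have "completely_positive (\<lambda>T. adj V o\<^sub>L (T o\<^sub>L V))"
    unfolding completely_positive_def positive_op_matrix_def
  proof (intro allI impI)
    fix n and a :: "nat \<Rightarrow> nat \<Rightarrow> ('a \<Rightarrow>\<^sub>L 'a)" and \<xi> :: "nat \<Rightarrow> 'a"
    assume pos: "\<forall>\<xi>. (\<Sum>i<n. cinner (\<Sum>j<n. a i j (\<xi> j)) (\<xi> i)) \<in> \<real>\<^sub>\<ge>\<^sub>0"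
    show "(\<Sum>i<n. cinner (\<Sum>j<n. (adj V o\<^sub>L (a i j o\<^sub>L V)) (\<xi> j)) (\<xi> i)) \<in> \<real>\<^sub>\<ge>\<^sub>0"
      using pos[rule_format, of "\<lambda>i. V (\<xi> i)"] Vb
      by (simp add: cinner_adj[of "adj V"] flip: blinfun.sum_right)
  qed
  moreover have "adj V o\<^sub>L (scaleC_op c T o\<^sub>L V) = scaleC_op c (adj V o\<^sub>L (T o\<^sub>L V))" for c T
    using adj_bounded_ops[OF Vb]
    by (intro blinfun_eqI) (simp add: scaleC_op.rep_eq bounded_ops_def)
  moreover have "adj V o\<^sub>L ((S + T) o\<^sub>L V) = (adj V o\<^sub>L (S o\<^sub>L V)) + (adj V o\<^sub>L (T o\<^sub>L V))" for S T
    by (simp add: blinfun_compose_simps)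
  moreover have "(\<lambda>T. adj V o\<^sub>L (T o\<^sub>L V)) ` bounded_ops \<subseteq> bounded_ops"
    using Vb by (intro image_subsetI) simp
  ultimately show ?thesis
    unfolding ucp_def using isometry_adj_compose[OF V] by (intro conjI ballI allI) simp_all
qed


section \<open>Asymptotic multiplicative domains\<close>

text \<open>Only the defect at \<open>a\<close> has to vanish in the limit: the defect at
  \<open>b\<close> enters Cauchy-Schwarz as a bounded factor.\<close>

lemma ucp_asymptotic_multiplicative:
  fixes \<phi> :: "nat \<Rightarrow> ('a::complex_hilbert \<Rightarrow>\<^sub>L 'a) \<Rightarrow> ('a \<Rightarrow>\<^sub>L 'a)"
  assumes ucp: "\<And>n. ucp (\<phi> n)" and a: "a \<in> bounded_ops" and b: "b \<in> bounded_ops"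
    and lim_a: "(\<lambda>n. \<phi> n a) \<longlonglongrightarrow> a" and lim_aa: "(\<lambda>n. \<phi> n (adj a o\<^sub>L a)) \<longlonglongrightarrow> (adj a o\<^sub>L a)"
    and lim_b: "(\<lambda>n. \<phi> n b) \<longlonglongrightarrow> b"
  shows "(\<lambda>n. \<phi> n (adj a o\<^sub>L b)) \<longlonglongrightarrow> (adj a o\<^sub>L b)"
proof -
  define E where "E n = \<phi> n (adj a o\<^sub>L b) - (adj (\<phi> n a) o\<^sub>L \<phi> n b)" for n
  define D where "D n = \<phi> n (adj a o\<^sub>L a) - (adj (\<phi> n a) o\<^sub>L \<phi> n a)" for n
  have adj_lim: "(\<lambda>n. adj (\<phi> n a)) \<longlonglongrightarrow> adj a"
    by (intro tendsto_adj lim_a a ucpD(1)[OF ucp])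
  have "D \<longlonglongrightarrow> (adj a o\<^sub>L a) - (adj a o\<^sub>L a)"
    unfolding D_def by (intro tendsto_diff lim_aa tendsto_blinfun_compose adj_lim lim_a)
  then have D: "(\<lambda>n. norm (D n)) \<longlonglongrightarrow> 0" by (simp add: tendsto_norm_zero)
  \<comment> \<open>The factor 2 counts the two terms of the defect at \<open>b\<close>, each of
    norm at most \<open>(norm b)\<^sup>2\<close>.\<close>
  have le: "(norm (E n))\<^sup>2 \<le> norm (D n) * (2 * (norm b)\<^sup>2)" for n
  proof -
    let ?\<phi> = "\<phi> n"
    have *: "norm (adj S o\<^sub>L S) \<le> (norm b)\<^sup>2" if "S \<in> bounded_ops" "norm S \<le> norm b" for S
    proof -
      have "norm (adj S o\<^sub>L S) \<le> norm (adj S) * norm S" by (rule norm_blinfun_compose)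
      also have "\<dots> \<le> norm b * norm b"
        using norm_adj_le[OF that(1)] that(2) by (intro mult_mono) auto
      finally show ?thesis by (simp add: power2_eq_square)
    qed
    have "norm (?\<phi> (adj b o\<^sub>L b)) \<le> norm (adj b o\<^sub>L b)"
      using b by (intro ucp_norm_le[OF ucp]) simp
    also have "\<dots> \<le> (norm b)\<^sup>2" using b by (intro *) auto
    finally have "norm (?\<phi> (adj b o\<^sub>L b)) \<le> (norm b)\<^sup>2" .
    moreover have "norm (adj (?\<phi> b) o\<^sub>L ?\<phi> b) \<le> (norm b)\<^sup>2"
      using b by (intro * ucpD(1)[OF ucp] ucp_norm_le[OF ucp])
    ultimately have "norm (?\<phi> (adj b o\<^sub>L b) - (adj (?\<phi> b) o\<^sub>L ?\<phi> b)) \<le> 2 * (norm b)\<^sup>2"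
      by (smt (verit) norm_triangle_ineq4)
    then have "norm (D n) * norm (?\<phi> (adj b o\<^sub>L b) - (adj (?\<phi> b) o\<^sub>L ?\<phi> b))
        \<le> norm (D n) * (2 * (norm b)\<^sup>2)"
      by (intro mult_left_mono) auto
    then show ?thesis
      using ucp_cauchy_schwarz[OF ucp a b, of n] unfolding D_def E_def by linarith
  qed
  have "(\<lambda>n. norm (D n) * (2 * (norm b)\<^sup>2)) \<longlonglongrightarrow> 0"
    by (rule tendsto_mult_left_zero[OF D])
  then have "(\<lambda>n. (norm (E n))\<^sup>2) \<longlonglongrightarrow> 0"
    by (rule Lim_null_comparison[rotated]) (simp add: le)
  then have "(\<lambda>n. sqrt ((norm (E n))\<^sup>2)) \<longlonglongrightarrow> sqrt 0" by (rule tendsto_real_sqrt)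
  then have "E \<longlonglongrightarrow> 0" by (simp add: tendsto_norm_zero_iff)
  then have "(\<lambda>n. E n + (adj (\<phi> n a) o\<^sub>L \<phi> n b)) \<longlonglongrightarrow> 0 + (adj a o\<^sub>L b)"
    by (intro tendsto_add tendsto_blinfun_compose adj_lim lim_b)
  then show ?thesis by (simp add: E_def)
qed

text \<open>The multipliers of the fixed points of the limit; unlike the fixed points themselves they
  form an algebra.\<close>

definition asymptotic_multipliers ::
    "(nat \<Rightarrow> ('a::complex_hilbert \<Rightarrow>\<^sub>L 'a) \<Rightarrow> ('a \<Rightarrow>\<^sub>L 'a)) \<Rightarrow> ('a \<Rightarrow>\<^sub>L 'a) set" where
  "asymptotic_multipliers \<phi> = {T \<in> bounded_ops. \<forall>S\<in>bounded_ops.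
     (\<lambda>n. \<phi> n S) \<longlonglongrightarrow> S \<longrightarrow> (\<lambda>n. \<phi> n (T o\<^sub>L S)) \<longlonglongrightarrow> (T o\<^sub>L S)}"

lemma asymptotic_multipliersD:
  fixes S T :: "'a::complex_hilbert \<Rightarrow>\<^sub>L 'a"
  shows
  "\<lbrakk>T \<in> asymptotic_multipliers \<phi>; S \<in> bounded_ops; (\<lambda>n. \<phi> n S) \<longlonglongrightarrow> S\<rbrakk>
    \<Longrightarrow> (\<lambda>n. \<phi> n (T o\<^sub>L S)) \<longlonglongrightarrow> (T o\<^sub>L S)"
  by (simp add: asymptotic_multipliers_def)

section \<open>Algebraic structure and closedness of the multipliers\<close>

context
  fixes \<phi> :: "nat \<Rightarrow> ('a::complex_hilbert \<Rightarrow>\<^sub>L 'a) \<Rightarrow> ('a \<Rightarrow>\<^sub>L 'a)"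
  assumes ucp: "\<And>n. ucp (\<phi> n)"
begin

lemma asymptotic_multipliers_bounded_ops:
  "T \<in> asymptotic_multipliers \<phi> \<Longrightarrow> T \<in> bounded_ops"
  by (simp add: asymptotic_multipliers_def)

text \<open>Multiply the identity, which every \<open>\<phi> n\<close> fixes.\<close>

lemma asymptotic_multipliers_tendsto:
  "T \<in> asymptotic_multipliers \<phi> \<Longrightarrow> (\<lambda>n. \<phi> n T) \<longlonglongrightarrow> T"
  using asymptotic_multipliersD[of T \<phi> id_blinfun] by (simp add: ucpD(4)[OF ucp])

lemma asymptotic_multipliers_zero: "0 \<in> asymptotic_multipliers \<phi>"
  using ucp_scaleR[OF ucp, of 0 _ 0] by (simp add: asymptotic_multipliers_def)

lemma asymptotic_multipliers_add:
  assumes "S \<in> asymptotic_multipliers \<phi>" "T \<in> asymptotic_multipliers \<phi>"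
  shows "S + T \<in> asymptotic_multipliers \<phi>"
  unfolding asymptotic_multipliers_def
proof (intro CollectI conjI ballI impI)
  have ST: "S \<in> bounded_ops" "T \<in> bounded_ops"
    using assms by (simp_all add: asymptotic_multipliers_def)
  then show "S + T \<in> bounded_ops" by simp
  fix R assume R: "R \<in> bounded_ops" "(\<lambda>n. \<phi> n R) \<longlonglongrightarrow> R"
  have "(\<lambda>n. \<phi> n (S o\<^sub>L R) + \<phi> n (T o\<^sub>L R)) \<longlonglongrightarrow> (S o\<^sub>L R) + (T o\<^sub>L R)"
    by (intro tendsto_add asymptotic_multipliersD assms R)
  then show "(\<lambda>n. \<phi> n ((S + T) o\<^sub>L R)) \<longlonglongrightarrow> ((S + T) o\<^sub>L R)"
    using ST R by (simp add: blinfun_compose_simps ucpD(2)[OF ucp])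
qed

lemma asymptotic_multipliers_compose:
  assumes "S \<in> asymptotic_multipliers \<phi>" "T \<in> asymptotic_multipliers \<phi>"
  shows "S o\<^sub>L T \<in> asymptotic_multipliers \<phi>"
  using assms by (simp add: asymptotic_multipliers_def blinfun_compose_assoc)

lemma asymptotic_multipliers_scaleC_op:
  assumes T: "T \<in> asymptotic_multipliers \<phi>"
  shows "scaleC_op c T \<in> asymptotic_multipliers \<phi>"
proof -
  have *: "scaleC_op c T o\<^sub>L S = scaleC_op c (T o\<^sub>L S)" for S
    by (rule blinfun_eqI) (simp add: scaleC_op.rep_eq)
  \<comment> \<open>Expressing the scalar as a left factor reduces its continuity to that of
    composition.\<close>
  have id: "scaleC_op c T = scaleC_op c id_blinfun o\<^sub>L T" for T :: "'a \<Rightarrow>\<^sub>L 'a"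
    by (rule blinfun_eqI) (simp add: scaleC_op.rep_eq)
  have "(\<lambda>n. scaleC_op c (\<phi> n S)) \<longlonglongrightarrow> scaleC_op c S" if "(\<lambda>n. \<phi> n S) \<longlonglongrightarrow> S" for S
    unfolding id[of "\<phi> _ S"] id[of S] by (intro tendsto_blinfun_compose tendsto_const that)
  then show ?thesis
    using T by (simp add: asymptotic_multipliers_def * ucpD[OF ucp])
qed

text \<open>An argument with three errors below \<open>e / 3\<close>: since UCP maps are
  contractive, one approximant \<open>f k\<close> serves all \<open>n\<close> at once.\<close>

lemma closed_asymptotic_multipliers: "closed (asymptotic_multipliers \<phi>)"
proof (rule closed_sequential_limits[THEN iffD2], intro allI impI)
  fix f T assume "(\<forall>k. f k \<in> asymptotic_multipliers \<phi>) \<and> f \<longlonglongrightarrow> T"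
  then have f: "\<And>k. f k \<in> asymptotic_multipliers \<phi>" and lim: "f \<longlonglongrightarrow> T" by auto
  have fb: "\<And>k. f k \<in> bounded_ops" using f asymptotic_multipliers_bounded_ops by blast
  have T: "T \<in> bounded_ops"
    using closed_bounded_ops fb lim closed_sequentially by blast
  have "(\<lambda>n. \<phi> n (T o\<^sub>L S)) \<longlonglongrightarrow> (T o\<^sub>L S)"
    if S: "S \<in> bounded_ops" "(\<lambda>n. \<phi> n S) \<longlonglongrightarrow> S" for S
  proof (rule metric_LIMSEQ_I)
    fix e :: real assume e: "e > 0"
    have "(\<lambda>k. f k o\<^sub>L S) \<longlonglongrightarrow> (T o\<^sub>L S)"
      by (intro tendsto_blinfun_compose lim tendsto_const)
    from metric_LIMSEQ_D[OF this, of "e / 3"] e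
    obtain k where k: "norm ((f k o\<^sub>L S) - (T o\<^sub>L S)) < e / 3"
      unfolding dist_norm by fastforce
    obtain N where N: "\<And>n. n \<ge> N \<Longrightarrow> norm (\<phi> n (f k o\<^sub>L S) - (f k o\<^sub>L S)) < e / 3"
      using metric_LIMSEQ_D[OF asymptotic_multipliersD[OF f S], of "e / 3"] e
      unfolding dist_norm by fastforce
    have "dist (\<phi> n (T o\<^sub>L S)) (T o\<^sub>L S) < e" if "n \<ge> N" for n
    proof -
      have "norm (\<phi> n ((f k o\<^sub>L S) - (T o\<^sub>L S))) \<le> norm ((f k o\<^sub>L S) - (T o\<^sub>L S))"
        using fb T S by (intro ucp_norm_le[OF ucp]) simp
      then have "norm (\<phi> n (f k o\<^sub>L S) - \<phi> n (T o\<^sub>L S)) < e / 3"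
        using k fb T S by (simp add: ucp_diff[OF ucp])
      then show ?thesis using k N[OF that] unfolding dist_norm by norm
    qed
    then show "\<exists>N. \<forall>n\<ge>N. dist (\<phi> n (T o\<^sub>L S)) (T o\<^sub>L S) < e" by blast
  qed
  then show "T \<in> asymptotic_multipliers \<phi>" using T by (simp add: asymptotic_multipliers_def)
qed

text \<open>The elements of \<open>A\<close> whose images are multipliers together with their
  adjoints form a C*-algebra containing \<open>G\<close>, hence all of \<open>A\<close>.\<close>

lemma representation_asymptotic_fixed:
  assumes A: "cstar_subalgebra A" and id: "id_blinfun \<in> A" and \<pi>: "representation A \<pi>"
    and G: "G \<subseteq> A" "A = cstar_generated G"
    and mult: "\<And>g. g \<in> G \<Longrightarrow> \<pi> g \<in> asymptotic_multipliers \<phi>"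
    and mult_adj: "\<And>g. g \<in> G \<Longrightarrow> adj (\<pi> g) \<in> asymptotic_multipliers \<phi>"
    and a: "a \<in> A"
  shows "(\<lambda>n. \<phi> n (\<pi> a)) \<longlonglongrightarrow> \<pi> a"
proof -
  let ?M = "asymptotic_multipliers \<phi>"
  note A_simps = cstar_subalgebraD[OF A] representationD[OF \<pi>]
  \<comment> \<open>Multipliers act from the left, so closure under adjoints is built in.
    \<open>B\<close> consists of operators on the original space, where minimality of
    \<open>cstar_generated\<close> applies.\<close>
  define B where "B = {a \<in> A. \<pi> a \<in> ?M \<and> adj (\<pi> a) \<in> ?M}"
  have closed: "closed B"
  proof (rule closed_sequential_limits[THEN iffD2], intro allI impI)
    fix f l assume f: "(\<forall>k. f k \<in> B) \<and> f \<longlonglongrightarrow> l"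
    then have fA: "f k \<in> A" for k unfolding B_def by blast
    have l: "l \<in> A"
      using f fA cstar_subalgebraD(9)[OF A] closed_sequentially by blast
    have lim: "(\<lambda>k. \<pi> (f k)) \<longlonglongrightarrow> \<pi> l"
    proof (rule Lim_transform_bound[of _ "\<lambda>k. f k - l", THEN LIM_zero_cancel])
      show "(\<lambda>k. f k - l) \<longlonglongrightarrow> 0" using f by (intro LIM_zero) blast
      show "\<forall>\<^sub>F k in sequentially. norm (\<pi> (f k) - \<pi> l) \<le> norm (f k - l)"
        using fA l representation_norm_le[OF A \<pi> id] cstar_subalgebraD(6)[OF A]
        by (simp flip: representation_diff[OF A \<pi>])
    qed
    have lim_adj: "(\<lambda>k. adj (\<pi> (f k))) \<longlonglongrightarrow> adj (\<pi> l)"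
      using fA l by (intro tendsto_adj lim representationD(1)[OF \<pi>])
    have "\<pi> (f k) \<in> ?M" "adj (\<pi> (f k)) \<in> ?M" for k using f unfolding B_def by blast+
    then have "\<pi> l \<in> ?M" "adj (\<pi> l) \<in> ?M"
      using closed_sequentially[OF closed_asymptotic_multipliers _ lim]
        closed_sequentially[OF closed_asymptotic_multipliers _ lim_adj] by blast+
    with l show "l \<in> B" by (simp add: B_def)
  qed
  have zero: "0 \<in> B"
    using representationD(4)[OF \<pi>, of 0 0] asymptotic_multipliers_zero
    by (simp add: B_def A_simps)
  have "cstar_subalgebra B"
    unfolding cstar_subalgebra_def
  proof (intro conjI ballI allI)
    show "B \<subseteq> bounded_ops" using A_simps(1) by (auto simp: B_def)
    fix S T assume "S \<in> B" "T \<in> B"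
    then have S: "S \<in> A" "\<pi> S \<in> ?M" "adj (\<pi> S) \<in> ?M"
      and T: "T \<in> A" "\<pi> T \<in> ?M" "adj (\<pi> T) \<in> ?M" by (auto simp: B_def)
    show "S + T \<in> B"
      using S T by (simp add: B_def A_simps adj_add asymptotic_multipliers_add)
    show "S o\<^sub>L T \<in> B"
      using S T by (simp add: B_def A_simps adj_compose asymptotic_multipliers_compose)
  next
    fix c T assume "T \<in> B"
    then have T: "T \<in> A" "\<pi> T \<in> ?M" "adj (\<pi> T) \<in> ?M" by (auto simp: B_def)
    show "scaleC_op c T \<in> B"
      using T by (simp add: B_def A_simps adj_scaleC_op asymptotic_multipliers_scaleC_op)
    show "adj T \<in> B"
      using T by (simp add: B_def A_simps)
  qed (rule zero closed)+
  moreover have "G \<subseteq> B" using G mult mult_adj by (auto simp: B_def)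
  ultimately have "A \<subseteq> B" unfolding G(2) by (rule cstar_generated_least)
  then show ?thesis using a asymptotic_multipliers_tendsto by (auto simp: B_def)
qed

end


section \<open>Generators of the algebra of an isometry\<close>

lemma hyperrigidD:
  fixes \<pi> :: "('a::complex_hilbert \<Rightarrow>\<^sub>L 'a) \<Rightarrow> ('l::complex_hilbert \<Rightarrow>\<^sub>L 'l)"
  assumes "hyperrigid TYPE('l) A G" "faithful_representation A \<pi>" "\<And>n::nat. ucp (\<phi> n)"
    and "\<And>g. g \<in> G \<Longrightarrow> (\<lambda>n. norm (\<phi> n (\<pi> g) - \<pi> g)) \<longlonglongrightarrow> 0" and "a \<in> A"
  shows "(\<lambda>n. norm (\<phi> n (\<pi> a) - \<pi> a)) \<longlonglongrightarrow> 0"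
  using assms unfolding hyperrigid_def by blast

text \<open>The generated algebra is not unital by definition; it contains the identity as
  \<open>adj V o\<^sub>L V\<close>, which makes the results on unital algebras available.\<close>

lemma cstar_generated_isometry:
  assumes V: "is_isometry V"
  shows "cstar_subalgebra (cstar_generated {V})" "V \<in> cstar_generated {V}"
    "id_blinfun \<in> cstar_generated {V}" "V o\<^sub>L adj V \<in> cstar_generated {V}"
    "cstar_generated {V, V o\<^sub>L adj V} = cstar_generated {V}"
proof -
  have Vb: "V \<in> bounded_ops" using V by (simp add: is_isometry_def)
  show A: "cstar_subalgebra (cstar_generated {V})"
    using Vb by (intro cstar_subalgebra_generated) simp
  show VA: "V \<in> cstar_generated {V}" using cstar_generated_superset by blast
  show "id_blinfun \<in> cstar_generated {V}"
    using cstar_subalgebraD(7,8)[OF A] VA isometry_adj_compose[OF V] by metis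
  show P: "V o\<^sub>L adj V \<in> cstar_generated {V}"
    using cstar_subalgebraD(7,8)[OF A] VA by metis
  show "cstar_generated {V, V o\<^sub>L adj V} = cstar_generated {V}"
  proof
    show "cstar_generated {V, V o\<^sub>L adj V} \<subseteq> cstar_generated {V}"
      using VA P A by (intro cstar_generated_least) auto
    show "cstar_generated {V} \<subseteq> cstar_generated {V, V o\<^sub>L adj V}"
      using Vb cstar_generated_superset[of "{V, V o\<^sub>L adj V}"]
      by (intro cstar_generated_least cstar_subalgebra_generated) auto
  qed
qed

lemma isometry_hyperrigid:
  fixes V :: "'h::complex_hilbert \<Rightarrow>\<^sub>L 'h"
  assumes V: "is_isometry V"
  shows "hyperrigid TYPE('l::complex_hilbert) (cstar_generated {V}) {V, V o\<^sub>L adj V}"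
  unfolding hyperrigid_def
proof (intro conjI allI impI ballI)
  let ?A = "cstar_generated {V}"
  note A = cstar_generated_isometry[OF V]
  have Vb: "V \<in> bounded_ops" using V by (simp add: is_isometry_def)
  then show "generating_set ?A {V, V o\<^sub>L adj V}"
    using A by (simp add: generating_set_def)
  fix \<pi> :: "('h \<Rightarrow>\<^sub>L 'h) \<Rightarrow> ('l \<Rightarrow>\<^sub>L 'l)" and \<phi> a
  assume "faithful_representation ?A \<pi>" and ucp': "\<forall>n::nat. ucp (\<phi> n)" and a: "a \<in> ?A"
    and conv: "\<forall>g\<in>{V, V o\<^sub>L adj V}. (\<lambda>n. norm (\<phi> n (\<pi> g) - \<pi> g)) \<longlonglongrightarrow> 0"
  then have \<pi>: "representation ?A \<pi>" by (simp add: faithful_representation_def)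
  have ucp: "\<And>n. ucp (\<phi> n)" using ucp' by blast
  define W where "W = \<pi> V"
  have W: "W \<in> bounded_ops" using representationD(1)[OF \<pi>] A by (simp add: W_def)
  have WW: "\<pi> (V o\<^sub>L adj V) = W o\<^sub>L adj W"
    using representationD(5,6)[OF \<pi>] cstar_subalgebraD(8)[OF A(1)] A(2) by (simp add: W_def)
  have WW': "adj W o\<^sub>L W = id_blinfun"
    using representationD(5)[OF \<pi>, of "adj V" V] representationD(6)[OF \<pi>, of V]
      cstar_subalgebraD(8)[OF A(1)] A(2) representation_id[OF \<pi> A(3)] isometry_adj_compose[OF V]
    by (simp add: W_def)
  have lim_W: "(\<lambda>n. \<phi> n W) \<longlonglongrightarrow> W" and lim_WW: "(\<lambda>n. \<phi> n (W o\<^sub>L adj W)) \<longlonglongrightarrow> (W o\<^sub>L adj W)"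
    using conv WW by (auto simp: W_def intro: LIM_zero_cancel tendsto_norm_zero_cancel)
  have lim_W': "(\<lambda>n. \<phi> n (adj W)) \<longlonglongrightarrow> adj W"
    using tendsto_adj[OF lim_W ucpD(1)[OF ucp W] W] by (simp add: ucp_adj[OF ucp W])
  \<comment> \<open>Take \<open>W\<close> for \<open>a\<close>: the square to be controlled is the
    identity.\<close>
  have "adj W \<in> asymptotic_multipliers \<phi>"
    using W ucp_asymptotic_multiplicative[of \<phi> W, OF ucp W _ lim_W]
    by (simp add: asymptotic_multipliers_def WW' ucpD[OF ucp])
  \<comment> \<open>Take \<open>adj W\<close> for \<open>a\<close>: the square is now
    \<open>W o\<^sub>L adj W\<close>, and here the second generator enters.\<close>
  moreover have "W \<in> asymptotic_multipliers \<phi>"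
    using W ucp_asymptotic_multiplicative[of \<phi> "adj W", OF ucp _ _ lim_W'] lim_WW
    by (simp add: asymptotic_multipliers_def)
  ultimately have "(\<lambda>n. \<phi> n (\<pi> a)) \<longlonglongrightarrow> \<pi> a"
    using A a by (intro representation_asymptotic_fixed[OF ucp A(1) A(3) \<pi>, of "{V}"])
      (auto simp: W_def)
  then show "(\<lambda>n. norm (\<phi> n (\<pi> a) - \<pi> a)) \<longlonglongrightarrow> 0"
    by (intro tendsto_norm_zero LIM_zero)
qed

text \<open>Test the identity representation with a constant sequence of UCP maps: convergence on
  \<open>V o\<^sub>L adj V\<close> would force it to be the identity and \<open>V\<close> to be
  unitary.\<close>

lemma isometry_not_hyperrigid:
  fixes V :: "'h::complex_hilbert \<Rightarrow>\<^sub>L 'h"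
  assumes V: "is_isometry V" and not_unitary: "\<not> is_unitary V"
  shows "\<not> hyperrigid TYPE('h) (cstar_generated {V}) {V}"
proof
  let ?A = "cstar_generated {V}" and ?\<phi> = "\<lambda>T. adj V o\<^sub>L (T o\<^sub>L V)"
  note A = cstar_generated_isometry[OF V]
  note VV = isometry_adj_compose[OF V]
  have Vb: "V \<in> bounded_ops" using V by (simp add: is_isometry_def)
  \<comment> \<open>Nondegeneracy of the identity representation: the identity operator in
    \<open>?A\<close> already reaches every vector.\<close>
  have "x \<in> {blinfun_apply T x | T x. T \<in> ?A}" for x
    using A(3) by (auto intro!: exI[of _ id_blinfun])
  then have "{blinfun_apply T x | T x. T \<in> ?A} = UNIV" by blast
  then have id: "faithful_representation ?A (\<lambda>T. T)"
    using cstar_subalgebraD(1)[OF A(1)]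
    by (auto simp: faithful_representation_def representation_def)
  assume "hyperrigid TYPE('h) ?A {V}"
  moreover have "?\<phi> V = V" using VV by (simp flip: blinfun_compose_assoc)
  ultimately have "(\<lambda>n::nat. norm (?\<phi> (V o\<^sub>L adj V) - (V o\<^sub>L adj V))) \<longlonglongrightarrow> 0"
    using hyperrigidD[of ?A "{V}" "\<lambda>T. T" "\<lambda>_. ?\<phi>"] id ucp_conjugate_isometry[OF V] A(4) by simp
  moreover have "?\<phi> (V o\<^sub>L adj V) = id_blinfun"
    using VV by (metis blinfun_compose_assoc blinfun_compose_id(1))
  ultimately have "V o\<^sub>L adj V = id_blinfun" by (simp add: LIMSEQ_const_iff)
  then show False using not_unitary VV Vb by (simp add: is_unitary_def)
qed

text \<open>The type \<open>'l\<close> is arbitrary, so hyperrigidity holds over every Hilbert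
  space, while one failure, at \<open>'h\<close>, refutes it for \<open>{V}\<close>. The conjunct
  \<open>generating_set\<close> ensures that this failure concerns convergence and not
  generation.\<close>

theorem proposition4p4:
  fixes V :: "'h::complex_hilbert \<Rightarrow>\<^sub>L 'h"
  assumes separable: "\<exists>D :: 'h set. countable D \<and> closure D = UNIV"
    and isometry: "is_isometry V"
    and not_unitary: "\<not> is_unitary V"
  shows "hyperrigid TYPE('l::complex_hilbert) (cstar_generated {V}) {V, V o\<^sub>L adj V} \<and>
    (generating_set (cstar_generated {V}) {V} \<and>
     \<not> hyperrigid TYPE('h) (cstar_generated {V}) {V})"
  using isometry_hyperrigid[OF isometry] isometry_not_hyperrigid[OF isometry not_unitary] isometry
  by (simp add: generating_set_def is_isometry_def)

end
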